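(* Let $\mathcal{F}$ be a subalgebra-closed formation of solvable Leibniz algebras over a field $\mathbb{F}$. Let $L$ be a finite-dimensional solvable Leibniz algebra over $\mathbb{F}$ that is minimally not in $\mathcal{F}$, and suppose $\Phi(L)=0$. Then $L=A+H$, where $A$ is the unique minimal ideal of $L$ and $H$ is a subalgebra of $L$ complementing $A$ (so $A\cap H=0$). If $L$ is not a Lie algebra, then $A=\mathrm{Leib}(L)$, $A$ is self-centralizing in $L$ (i.e. $Z_L(A)=A$), $H$ is a Lie algebra, and the vector space direct sum $C=A+H$ with the product $$[a+h,\,b+k]=hb-ka+hk\qquad (a,b\in A,\ h,k\in H),$$ where the products on the right-hand side are taken in $L$, is a Lie algebra.
   Context: A (left) Leibniz algebra is an algebra satisfying $a(bc)=(ab)c+b(ac)$; it is a Lie algebra if its product is antisymmetric ($xx=0$ for all $x$). All algebras are finite-dimensional; ideals are two-sided. $\mathrm{Leib}(L)$ is the span of all squares $xx$, $x\in L$ (an ideal of $L$). The Frattini subalgebra of $L$ is the intersection of all maximal subalgebras of $L$; the Frattini ideal $\Phi(L)$ (also written $\phi(L)$) is the largest ideal of $L$ contained in the Frattini subalgebra. $Z_L(A)=\{x\in L: xa=ax=0 \text{ for all } a\in A\}$. A formation is a nonempty class of algebras (closed under isomorphism) that is closed under homomorphic images and such that $L/I\in\mathcal{F}$ and $L/J\in\mathcal{F}$ for ideals $I,J$ of $L$ imply $L/(I\cap J)\in\mathcal{F}$; it is subalgebra-closed if every subalgebra of a member is a member. $L$ is minimally not in $\mathcal{F}$ if $L\notin\mathcal{F}$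 but every proper subalgebra of $L$ is in $\mathcal{F}$. The algebra $C$ is called the companion Lie algebra of $L$. *)

theory Defs
  imports "HOL-Algebra.Module" "HOL-Algebra.QuotRing"
begin

text \<open>
  A not necessarily associative algebra over a field \<open>K\<close> is a \<open>K\<close>-module record whose multiplication
  field is bilinear. The field \<open>one\<close> of the record is never used; the notions below (in particular
  isomorphism) ignore it, and they ignore the values of the operations outside the carrier.
\<close>

locale nonassoc_algebra = K?: field K + L?: module K L for K (structure) and L (structure) +
  assumes mult_closed: "\<lbrakk>x \<in> carrier L; y \<in> carrier L\<rbrakk> \<Longrightarrow> x \<otimes>\<^bsub>L\<^esub> y \<in> carrier L"
    and mult_l_distr: "\<lbrakk>x \<in> carrier L; y \<in> carrier L; z \<in> carrier L\<rbrakk> \<Longrightarrow>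
      (x \<oplus>\<^bsub>L\<^esub> y) \<otimes>\<^bsub>L\<^esub> z = (x \<otimes>\<^bsub>L\<^esub> z) \<oplus>\<^bsub>L\<^esub> (y \<otimes>\<^bsub>L\<^esub> z)"
    and mult_r_distr: "\<lbrakk>x \<in> carrier L; y \<in> carrier L; z \<in> carrier L\<rbrakk> \<Longrightarrow>
      x \<otimes>\<^bsub>L\<^esub> (y \<oplus>\<^bsub>L\<^esub> z) = (x \<otimes>\<^bsub>L\<^esub> y) \<oplus>\<^bsub>L\<^esub> (x \<otimes>\<^bsub>L\<^esub> z)"
    and mult_smult_l: "\<lbrakk>c \<in> carrier K; x \<in> carrier L; y \<in> carrier L\<rbrakk> \<Longrightarrow>
      (c \<odot>\<^bsub>L\<^esub> x) \<otimes>\<^bsub>L\<^esub> y = c \<odot>\<^bsub>L\<^esub> (x \<otimes>\<^bsub>L\<^esub> y)"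
    and mult_smult_r: "\<lbrakk>c \<in> carrier K; x \<in> carrier L; y \<in> carrier L\<rbrakk> \<Longrightarrow>
      x \<otimes>\<^bsub>L\<^esub> (c \<odot>\<^bsub>L\<^esub> y) = c \<odot>\<^bsub>L\<^esub> (x \<otimes>\<^bsub>L\<^esub> y)"

locale leibniz_algebra = nonassoc_algebra +
  assumes leibniz: "\<lbrakk>x \<in> carrier L; y \<in> carrier L; z \<in> carrier L\<rbrakk> \<Longrightarrow>
      x \<otimes>\<^bsub>L\<^esub> (y \<otimes>\<^bsub>L\<^esub> z) = ((x \<otimes>\<^bsub>L\<^esub> y) \<otimes>\<^bsub>L\<^esub> z) \<oplus>\<^bsub>L\<^esub> (y \<otimes>\<^bsub>L\<^esub> (x \<otimes>\<^bsub>L\<^esub> z))"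

locale lie_algebra = leibniz_algebra +
  assumes square_zero: "x \<in> carrier L \<Longrightarrow> x \<otimes>\<^bsub>L\<^esub> x = \<zero>\<^bsub>L\<^esub>"

definition lin_span :: "('c, 'm) ring_scheme \<Rightarrow> ('c, 'a) module \<Rightarrow> 'a set \<Rightarrow> 'a set" where
  "lin_span K L S = \<Inter>{N. submodule N K L \<and> S \<subseteq> N}"

definition fin_dim :: "('c, 'm) ring_scheme \<Rightarrow> ('c, 'a) module \<Rightarrow> bool" where
  "fin_dim K L \<longleftrightarrow> (\<exists>S. finite S \<and> S \<subseteq> carrier L \<and> lin_span K L S = carrier L)"

definition subalgebra :: "('c, 'm) ring_scheme \<Rightarrow> ('c, 'a) module \<Rightarrow> 'a set \<Rightarrow> bool" where
  "subalgebra K L H \<longleftrightarrow> submodule H K L \<and> (\<forall>x\<in>H. \<forall>y\<in>H. x \<otimes>\<^bsub>L\<^esub> y \<in> H)"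

definition alg_ideal :: "('c, 'm) ring_scheme \<Rightarrow> ('c, 'a) module \<Rightarrow> 'a set \<Rightarrow> bool" where
  "alg_ideal K L I \<longleftrightarrow> submodule I K L \<and>
     (\<forall>x\<in>carrier L. \<forall>a\<in>I. x \<otimes>\<^bsub>L\<^esub> a \<in> I \<and> a \<otimes>\<^bsub>L\<^esub> x \<in> I)"

definition minimal_ideal :: "('c, 'm) ring_scheme \<Rightarrow> ('c, 'a) module \<Rightarrow> 'a set \<Rightarrow> bool" where
  "minimal_ideal K L A \<longleftrightarrow> alg_ideal K L A \<and> A \<noteq> {\<zero>\<^bsub>L\<^esub>} \<and>
     (\<forall>B. alg_ideal K L B \<and> B \<subseteq> A \<longrightarrow> B = {\<zero>\<^bsub>L\<^esub>} \<or> B = A)"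

definition maximal_subalgebra :: "('c, 'm) ring_scheme \<Rightarrow> ('c, 'a) module \<Rightarrow> 'a set \<Rightarrow> bool" where
  "maximal_subalgebra K L M \<longleftrightarrow> subalgebra K L M \<and> M \<noteq> carrier L \<and>
     (\<forall>N. subalgebra K L N \<and> M \<subseteq> N \<longrightarrow> N = M \<or> N = carrier L)"

text \<open>For the zero algebra, which has no maximal subalgebra, the intersection is the whole algebra.\<close>

definition frattini_subalgebra :: "('c, 'm) ring_scheme \<Rightarrow> ('c, 'a) module \<Rightarrow> 'a set" where
  "frattini_subalgebra K L = carrier L \<inter> \<Inter>{M. maximal_subalgebra K L M}"

definition frattini_ideal :: "('c, 'm) ring_scheme \<Rightarrow> ('c, 'a) module \<Rightarrow> 'a set" where
  "frattini_ideal K L = (GREATEST I. alg_ideal K L I \<and> I \<subseteq> frattini_subalgebra K L)"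

definition leib :: "('c, 'm) ring_scheme \<Rightarrow> ('c, 'a) module \<Rightarrow> 'a set" where
  "leib K L = lin_span K L {x \<otimes>\<^bsub>L\<^esub> x | x. x \<in> carrier L}"

definition alg_centralizer :: "('c, 'a) module \<Rightarrow> 'a set \<Rightarrow> 'a set" where
  "alg_centralizer L A =
     {x \<in> carrier L. \<forall>a\<in>A. x \<otimes>\<^bsub>L\<^esub> a = \<zero>\<^bsub>L\<^esub> \<and> a \<otimes>\<^bsub>L\<^esub> x = \<zero>\<^bsub>L\<^esub>}"

primrec derived_ser :: "('c, 'm) ring_scheme \<Rightarrow> ('c, 'a) module \<Rightarrow> nat \<Rightarrow> 'a set" where
  "derived_ser K L 0 = carrier L"
| "derived_ser K L (Suc n) =
     lin_span K L {x \<otimes>\<^bsub>L\<^esub> y | x y. x \<in> derived_ser K L n \<and> y \<in> derived_ser K L n}"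

definition solvable_algebra :: "('c, 'm) ring_scheme \<Rightarrow> ('c, 'a) module \<Rightarrow> bool" where
  "solvable_algebra K L \<longleftrightarrow> (\<exists>n. derived_ser K L n = {\<zero>\<^bsub>L\<^esub>})"

definition alg_hom :: "('c, 'm) ring_scheme \<Rightarrow> ('c, 'a) module \<Rightarrow> ('c, 'b) module \<Rightarrow> ('a \<Rightarrow> 'b) set"
  where "alg_hom K X Y = {f \<in> carrier X \<rightarrow> carrier Y.
     (\<forall>x\<in>carrier X. \<forall>y\<in>carrier X. f (x \<oplus>\<^bsub>X\<^esub> y) = f x \<oplus>\<^bsub>Y\<^esub> f y \<and> f (x \<otimes>\<^bsub>X\<^esub> y) = f x \<otimes>\<^bsub>Y\<^esub> f y) \<and>
     (\<forall>c\<in>carrier K. \<forall>x\<in>carrier X. f (c \<odot>\<^bsub>X\<^esub> x) = c \<odot>\<^bsub>Y\<^esub> f x)}"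

definition alg_isomorphic ::
  "('c, 'm) ring_scheme \<Rightarrow> ('c, 'a) module \<Rightarrow> ('c, 'b) module \<Rightarrow> bool" where
  "alg_isomorphic K X Y \<longleftrightarrow> (\<exists>f\<in>alg_hom K X Y. bij_betw f (carrier X) (carrier Y))"

text \<open>The quotient \<open>L/I\<close> on additive cosets: \<^const>\<open>FactRing\<close> extended by the scalar action.\<close>

definition quotient_algebra :: "('c, 'a) module \<Rightarrow> 'a set \<Rightarrow> ('c, 'a set) module" where
  "quotient_algebra L I = ring.extend (L Quot I)
     (module.fields (\<lambda>c X. \<Union>x\<in>X. I +>\<^bsub>L\<^esub> (c \<odot>\<^bsub>L\<^esub> x)))"

definition fd_leibniz_algebra :: "('c, 'm) ring_scheme \<Rightarrow> ('c, 'a) module \<Rightarrow> bool" where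
  "fd_leibniz_algebra K L \<longleftrightarrow> leibniz_algebra K L \<and> fin_dim K L"

text \<open>
  A class of algebras is represented by the set of its members whose elements have type \<open>'a\<close>, for an
  arbitrary type \<open>'a\<close>. A subalgebra of such an algebra, and up to isomorphism (pick coset
  representatives) each of its quotients, again has elements of type \<open>'a\<close>, so every formation in the
  class sense restricts to a formation in the sense below. The quotients themselves have elements of
  type \<open>'a set\<close>; hence their membership is expressed up to isomorphism.
\<close>

definition belongs_to ::
  "('c, 'm) ring_scheme \<Rightarrow> ('c, 'b) module \<Rightarrow> ('c, 'a) module set \<Rightarrow> bool" where
  "belongs_to K X \<F> \<longleftrightarrow> (\<exists>Y\<in>\<F>. alg_isomorphic K X Y)"

definition formation :: "('c, 'm) ring_scheme \<Rightarrow> ('c, 'a) module set \<Rightarrow> bool" where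
  "formation K \<F> \<longleftrightarrow>
     \<F> \<noteq> {} \<and>
     (\<forall>X\<in>\<F>. fd_leibniz_algebra K X) \<and>
     (\<forall>X\<in>\<F>. \<forall>Y. fd_leibniz_algebra K Y \<and> alg_isomorphic K X Y \<longrightarrow> Y \<in> \<F>) \<and>
     (\<forall>X\<in>\<F>. \<forall>Y. fd_leibniz_algebra K Y \<and> (\<exists>f\<in>alg_hom K X Y. f ` carrier X = carrier Y) \<longrightarrow> Y \<in> \<F>) \<and>
     (\<forall>(X :: ('c, 'a) module) I J. fd_leibniz_algebra K X \<and> alg_ideal K X I \<and> alg_ideal K X J \<and>
        belongs_to K (quotient_algebra X I) \<F> \<and> belongs_to K (quotient_algebra X J) \<F> \<longrightarrow>
        belongs_to K (quotient_algebra X (I \<inter> J)) \<F>)"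

definition subalgebra_closed :: "('c, 'm) ring_scheme \<Rightarrow> ('c, 'a) module set \<Rightarrow> bool" where
  "subalgebra_closed K \<F> \<longleftrightarrow> (\<forall>X\<in>\<F>. \<forall>H. subalgebra K X H \<longrightarrow> X\<lparr>carrier := H\<rparr> \<in> \<F>)"

definition minimally_not_in ::
  "('c, 'm) ring_scheme \<Rightarrow> ('c, 'a) module \<Rightarrow> ('c, 'a) module set \<Rightarrow> bool" where
  "minimally_not_in K L \<F> \<longleftrightarrow> L \<notin> \<F> \<and>
     (\<forall>H. subalgebra K L H \<and> H \<noteq> carrier L \<longrightarrow> L\<lparr>carrier := H\<rparr> \<in> \<F>)"

definition complementing_subalgebra ::
  "('c, 'm) ring_scheme \<Rightarrow> ('c, 'a) module \<Rightarrow> 'a set \<Rightarrow> 'a set \<Rightarrow> bool" where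
  "complementing_subalgebra K L A H \<longleftrightarrow>
     subalgebra K L H \<and> carrier L = A <+>\<^bsub>L\<^esub> H \<and> A \<inter> H = {\<zero>\<^bsub>L\<^esub>}"

text \<open>
  The bracket is read off the decompositions \<open>x = a + h\<close>, \<open>y = b + k\<close>, which are unique when the sum
  of \<open>A\<close> and \<open>H\<close> is direct.
\<close>

definition companion :: "('c, 'a) module \<Rightarrow> 'a set \<Rightarrow> 'a set \<Rightarrow> ('c, 'a) module" where
  "companion L A H = L\<lparr>carrier := A <+>\<^bsub>L\<^esub> H,
     mult := \<lambda>x y. THE z. \<exists>a\<in>A. \<exists>b\<in>A. \<exists>h\<in>H. \<exists>k\<in>H.
       x = a \<oplus>\<^bsub>L\<^esub> h \<and> y = b \<oplus>\<^bsub>L\<^esub> k \<and>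
       z = ((h \<otimes>\<^bsub>L\<^esub> b) \<ominus>\<^bsub>L\<^esub> (k \<otimes>\<^bsub>L\<^esub> a)) \<oplus>\<^bsub>L\<^esub> (h \<otimes>\<^bsub>L\<^esub> k)\<rparr>"

end

theory Submission
  imports Defs
begin

no_notation Sum_Type.Plus (infixr \<open><+>\<close> 65)

text \<open>
  A minimal ideal \<open>A\<close> is abelian by solvability, and since it is not contained in the Frattini
  subalgebra it is complemented by a maximal subalgebra \<open>M\<close>; so \<open>L/A \<cong> M\<close> lies in the formation.
  Two distinct minimal ideals \<open>A\<close>, \<open>B\<close> would put \<open>L/(A \<inter> B) = L\<close> into the formation as well; so
  \<open>A\<close> is unique and is contained in every nonzero ideal. If \<open>N \<supseteq> A\<close> is an ideal annihilated by \<open>A\<close>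
  on both sides, then \<open>N \<inter> H\<close> is an ideal of \<open>A + H = L\<close> that meets \<open>A\<close> trivially, whence \<open>N = A\<close>.
  This applies to the centralizer of \<open>A\<close> and, because left multiplication by an element of
  \<open>Leib(L)\<close> vanishes, to \<open>Leib(L)\<close>. Finally \<open>hh \<in> Leib(L) \<inter> H = 0\<close> for \<open>h \<in> H\<close>, and the identities of
  the companion algebra reduce to the Leibniz identity in \<open>L\<close>.
\<close>

section \<open>Spans and finite dimension\<close>

text \<open>Only \<open>L\<close> is a structure parameter, so unsubscripted operations refer to the
  algebra and not to its scalars. The locales \<open>algebra_over\<close> and
  \<open>leibniz_alg\<close> keep this convention; facts about the additive group of
  \<open>L\<close> carry the prefix \<open>M\<close>.\<close>

locale vspace = K?: field K + L?: module K L
  for K :: "('c, 'm) ring_scheme" and L :: "('c, 'a) module" (structure)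
begin

lemma submodule_zero_mem: "submodule N K L \<Longrightarrow> \<zero> \<in> N"
  using subgroup.one_closed[OF submodule.axioms(1)] by fastforce

lemma submodule_subset: "submodule N K L \<Longrightarrow> x \<in> N \<Longrightarrow> x \<in> carrier L"
  using submoduleE(1) by blast

lemma submodule_minus_mem: "submodule N K L \<Longrightarrow> x \<in> N \<Longrightarrow> y \<in> N \<Longrightarrow> x \<ominus> y \<in> N"
  by (simp add: submoduleE(3) submoduleE(5) a_minus_def)

lemma submodule_add_left_cancel:
  assumes N: "submodule N K L" and "a \<in> N" "x \<in> carrier L" "a \<oplus> x \<in> N"
  shows "x \<in> N"
proof -
  have "\<ominus> a \<oplus> (a \<oplus> x) \<in> N"
    using assms(2,4) submoduleE(3,5)[OF N] by blast
  then show ?thesis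
    by (simp add: M.r_neg1[OF submodule_subset[OF N assms(2)] assms(3)])
qed

lemma submodule_Inter:
  assumes "\<And>N. N \<in> \<N> \<Longrightarrow> submodule N K L" and "\<N> \<noteq> {}"
  shows "submodule (\<Inter>\<N>) K L"
proof (rule submoduleI)
  show "\<Inter>\<N> \<subseteq> carrier L"
    using assms submodule_subset by blast
  show "\<zero> \<in> \<Inter>\<N>"
    using assms(1) submodule_zero_mem by auto
  show "\<ominus> x \<in> \<Inter>\<N>" if "x \<in> \<Inter>\<N>" for x
    using that submoduleE(3)[OF assms(1)] by auto
  show "x \<oplus> y \<in> \<Inter>\<N>" if "x \<in> \<Inter>\<N>" "y \<in> \<Inter>\<N>" for x y
    using that submoduleE(5)[OF assms(1)] by auto
  show "c \<odot> x \<in> \<Inter>\<N>" if "c \<in> carrier K" "x \<in> \<Inter>\<N>" for c x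
    using that submoduleE(4)[OF assms(1)] by auto
qed

lemma submodule_Int: "submodule M K L \<Longrightarrow> submodule N K L \<Longrightarrow> submodule (M \<inter> N) K L"
  using submodule_Inter[of "{M, N}"] by auto

lemma submodule_zero: "submodule {\<zero>} K L"
  by (rule submoduleI) auto

lemma lin_span_superset: "S \<subseteq> lin_span K L S"
  unfolding lin_span_def by blast

lemma lin_span_least: "submodule N K L \<Longrightarrow> S \<subseteq> N \<Longrightarrow> lin_span K L S \<subseteq> N"
  unfolding lin_span_def by blast

lemma lin_span_mono: "S \<subseteq> T \<Longrightarrow> lin_span K L S \<subseteq> lin_span K L T"
  unfolding lin_span_def by blast

lemma submodule_lin_span: "S \<subseteq> carrier L \<Longrightarrow> submodule (lin_span K L S) K L"
  unfolding lin_span_def using carrier_is_submodule by (intro submodule_Inter) auto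

lemma mem_set_add: "x \<in> A <+> B \<longleftrightarrow> (\<exists>a\<in>A. \<exists>b\<in>B. x = a \<oplus> b)"
  by (auto simp: set_add_def')

lemma add_interchange:
  assumes "a \<in> carrier L" "b \<in> carrier L" "c \<in> carrier L" "d \<in> carrier L"
  shows "(a \<oplus> b) \<oplus> (c \<oplus> d) = (a \<oplus> c) \<oplus> (b \<oplus> d)"
  using assms by (simp add: M.a_ac)

lemma submodule_set_add:
  assumes A: "submodule A K L" and B: "submodule B K L"
  shows "submodule (A <+> B) K L"
proof (rule submoduleI)
  note s = submodule_subset[OF A] submodule_subset[OF B]
  show "A <+> B \<subseteq> carrier L"
    using s by (auto simp: mem_set_add)
  show "\<zero> \<in> A <+> B"
    using submodule_zero_mem[OF A] submodule_zero_mem[OF B] by (force simp: mem_set_add)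
  show "\<ominus> x \<in> A <+> B" if x: "x \<in> A <+> B" for x
  proof -
    obtain a b where ab: "a \<in> A" "b \<in> B" "x = a \<oplus> b" using x by (auto simp: mem_set_add)
    then have "\<ominus> x = \<ominus> a \<oplus> \<ominus> b" using s by (simp add: M.minus_add)
    then show ?thesis using ab submoduleE(3)[OF A] submoduleE(3)[OF B] by (auto simp: mem_set_add)
  qed
  show "x \<oplus> y \<in> A <+> B" if xy: "x \<in> A <+> B" "y \<in> A <+> B" for x y
  proof -
    obtain a b where ab: "a \<in> A" "b \<in> B" "x = a \<oplus> b" using xy by (auto simp: mem_set_add)
    obtain c d where cd: "c \<in> A" "d \<in> B" "y = c \<oplus> d" using xy by (auto simp: mem_set_add)
    have "x \<oplus> y = (a \<oplus> c) \<oplus> (b \<oplus> d)" using ab cd s by (simp add: add_interchange)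
    moreover have "a \<oplus> c \<in> A" "b \<oplus> d \<in> B"
      using ab cd submoduleE(5)[OF A] submoduleE(5)[OF B] by auto
    ultimately show ?thesis by (auto simp: mem_set_add)
  qed
  show "c \<odot> x \<in> A <+> B" if c: "c \<in> carrier K" and x: "x \<in> A <+> B" for c x
  proof -
    obtain a b where ab: "a \<in> A" "b \<in> B" "x = a \<oplus> b" using x by (auto simp: mem_set_add)
    have "c \<odot> x = c \<odot> a \<oplus> c \<odot> b" using s ab c by (simp add: smult_r_distr)
    moreover have "c \<odot> a \<in> A" "c \<odot> b \<in> B"
      using ab c submoduleE(4)[OF A] submoduleE(4)[OF B] by auto
    ultimately show ?thesis by (auto simp: mem_set_add)
  qed
qed

lemma subset_set_add:
  assumes "submodule A K L" "submodule B K L"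
  shows "A \<subseteq> A <+> B" "B \<subseteq> A <+> B"
proof -
  have "a = a \<oplus> \<zero>" if "a \<in> A" for a using that submodule_subset[OF assms(1)] by simp
  moreover have "b = \<zero> \<oplus> b" if "b \<in> B" for b using that submodule_subset[OF assms(2)] by simp
  ultimately show "A \<subseteq> A <+> B" "B \<subseteq> A <+> B"
    using submodule_zero_mem[OF assms(1)] submodule_zero_mem[OF assms(2)]
    by (auto simp: mem_set_add) metis+
qed

lemma submodule_line:
  assumes "t \<in> carrier L"
  shows "submodule ((\<lambda>c. c \<odot> t) ` carrier K) K L"
proof (rule submoduleI)
  show "\<zero> \<in> (\<lambda>c. c \<odot> t) ` carrier K"
    using smult_l_null[OF assms] by (metis K.zero_closed imageI)
  show "\<ominus> x \<in> (\<lambda>c. c \<odot> t) ` carrier K" if "x \<in> (\<lambda>c. c \<odot> t) ` carrier K" for x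
    using that assms by (force simp flip: smult_l_minus)
  show "x \<oplus> y \<in> (\<lambda>c. c \<odot> t) ` carrier K"
    if "x \<in> (\<lambda>c. c \<odot> t) ` carrier K" "y \<in> (\<lambda>c. c \<odot> t) ` carrier K" for x y
    using that assms by (force simp flip: smult_l_distr)
  show "d \<odot> x \<in> (\<lambda>c. c \<odot> t) ` carrier K"
    if "d \<in> carrier K" "x \<in> (\<lambda>c. c \<odot> t) ` carrier K" for d x
    using that assms by (force simp flip: smult_assoc1)
qed (use assms in auto)

section \<open>Exchange property and codimension of submodules\<close>

lemma lin_span_insertE:
  assumes "x \<in> lin_span K L (insert t S)" "S \<subseteq> carrier L" "t \<in> carrier L"
  obtains y c where "y \<in> lin_span K L S" "c \<in> carrier K" "x = y \<oplus> c \<odot> t"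
proof -
  let ?T = "(\<lambda>c. c \<odot> t) ` carrier K"
  have sub: "submodule (lin_span K L S) K L" "submodule ?T K L"
    using assms submodule_lin_span submodule_line by auto
  have "t = \<one>\<^bsub>K\<^esub> \<odot> t" using assms by simp
  then have "t \<in> ?T" by (metis K.one_closed imageI)
  then have "insert t S \<subseteq> lin_span K L S <+> ?T"
    using subset_set_add[OF sub] lin_span_superset[of S] by auto
  then have "lin_span K L (insert t S) \<subseteq> lin_span K L S <+> ?T"
    by (intro lin_span_least submodule_set_add sub)
  then show thesis using assms(1) that by (auto simp: mem_set_add subset_iff)
qed

text \<open>Steinitz exchange relative to \<open>N\<close>, by induction on \<open>T\<close>. If the
  newly inserted vector \<open>t\<close> is essential for writing \<open>x\<close>, its coefficient
  is nonzero and the equation can be solved for \<open>t\<close>; otherwise the induction hypothesis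
  supplies the vector.\<close>

lemma lin_span_exchange:
  assumes N: "submodule N K L" and "x \<notin> N" "finite T"
    and "T \<subseteq> carrier L" "x \<in> lin_span K L (N \<union> T)"
  shows "\<exists>t\<in>T. t \<in> lin_span K L (insert x (N \<union> (T - {t})))"
  using assms(3-5)
proof (induction T)
  case empty
  then show ?case using lin_span_least[OF N, of N] \<open>x \<notin> N\<close> by auto
next
  case (insert t T)
  have NT: "N \<union> T \<subseteq> carrier L" and t: "t \<in> carrier L"
    using insert.prems(1) submoduleE(1)[OF N] by auto
  show ?case
  proof (cases "x \<in> lin_span K L (N \<union> T)")
    case True
    then obtain s where s: "s \<in> T" "s \<in> lin_span K L (insert x (N \<union> (T - {s})))"
      using insert NT by blast
    then have "s \<in> lin_span K L (insert x (N \<union> (insert t T - {s})))"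
      using lin_span_mono[of "insert x (N \<union> (T - {s}))" "insert x (N \<union> (insert t T - {s}))"]
      by blast
    then show ?thesis using s by blast
  next
    case False
    have "x \<in> lin_span K L (insert t (N \<union> T))" using insert.prems by simp
    then obtain y c where y: "y \<in> lin_span K L (N \<union> T)" and c: "c \<in> carrier K"
      and x: "x = y \<oplus> c \<odot> t"
      using lin_span_insertE[OF _ NT t] by metis
    have yc: "y \<in> carrier L" using y submodule_lin_span[OF NT] submodule_subset by blast
    have xc: "x \<in> carrier L" using x yc c t by simp
    have "c \<noteq> \<zero>\<^bsub>K\<^esub>" using False x y yc t by auto
    then have cU: "c \<in> Units K" using c by (simp add: K.field_Units)
    define d where "d = inv\<^bsub>K\<^esub> c"
    have d: "d \<in> carrier K" "d \<otimes>\<^bsub>K\<^esub> c = \<one>\<^bsub>K\<^esub>" using cU by (auto simp: d_def)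
    let ?S = "insert x (N \<union> T)"
    have sub: "submodule (lin_span K L ?S) K L" using NT xc by (intro submodule_lin_span) auto
    have "c \<odot> t = x \<ominus> y" using yc c t unfolding x a_minus_def by (simp add: M.a_comm[of y] M.a_assoc M.r_neg)
    moreover have "x \<ominus> y \<in> lin_span K L ?S"
      using y lin_span_superset[of ?S] lin_span_mono[of "N \<union> T" ?S]
      by (intro submodule_minus_mem[OF sub]) auto
    ultimately have "d \<odot> (c \<odot> t) \<in> lin_span K L ?S" using submoduleE(4)[OF sub] d by auto
    then have "t \<in> lin_span K L ?S" using d c t by (simp flip: smult_assoc1)
    moreover have "insert t T - {t} = T" using insert.hyps by auto
    ultimately show ?thesis by auto
  qed
qed

text \<open>In a finite-dimensional \<open>L\<close> this is the dimension of \<open>L\<close>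
  modulo the submodule \<open>N\<close>. The form as a least number of extra generators makes it
  comparable by exchanging single vectors, without bases.\<close>

definition codim :: "'a set \<Rightarrow> nat" where
  "codim N = (LEAST n. \<exists>T. finite T \<and> T \<subseteq> carrier L \<and> card T = n \<and>
     lin_span K L (N \<union> T) = carrier L)"

lemma codim_le:
  assumes "finite T" "T \<subseteq> carrier L" "lin_span K L (N \<union> T) = carrier L"
  shows "codim N \<le> card T"
  unfolding codim_def using assms by (intro Least_le) blast

text \<open>Any \<open>x\<close> in \<open>M\<close> outside \<open>N\<close> can replace some
  \<open>t\<close> in a smallest set \<open>T\<close> that completes \<open>N\<close> to a
  generating set. Since \<open>M\<close> already contains \<open>x\<close>, the smaller set
  \<open>T - {t}\<close> completes \<open>M\<close>.\<close>

lemma codim_less: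
  assumes "fin_dim K L" and M: "submodule M K L" and N: "submodule N K L" and "N \<subset> M"
  shows "codim M < codim N"
proof -
  obtain S where S: "finite S" "S \<subseteq> carrier L" "lin_span K L S = carrier L"
    using \<open>fin_dim K L\<close> unfolding fin_dim_def by blast
  have "lin_span K L (N \<union> S) = carrier L"
    using S lin_span_mono[of S "N \<union> S"] submoduleE(1)[OF submodule_lin_span, of "N \<union> S"]
      submoduleE(1)[OF N] by auto
  then have "\<exists>n T. finite T \<and> T \<subseteq> carrier L \<and> card T = n \<and> lin_span K L (N \<union> T) = carrier L"
    using S by blast
  then have "\<exists>T. finite T \<and> T \<subseteq> carrier L \<and> card T = codim N \<and>
      lin_span K L (N \<union> T) = carrier L"
    unfolding codim_def by (rule LeastI_ex)
  then obtain T where T: "finite T" "T \<subseteq> carrier L" "card T = codim N"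
    "lin_span K L (N \<union> T) = carrier L" by blast
  obtain x where x: "x \<in> M" "x \<notin> N" using \<open>N \<subset> M\<close> by blast
  have "x \<in> lin_span K L (N \<union> T)" using T x submodule_subset[OF M] by simp
  from lin_span_exchange[OF N x(2) T(1) T(2) this]
  obtain t where t: "t \<in> T" "t \<in> lin_span K L (insert x (N \<union> (T - {t})))" by blast
  let ?R = "M \<union> (T - {t})"
  have sub: "submodule (lin_span K L ?R) K L"
    using T submoduleE(1)[OF M] by (intro submodule_lin_span) auto
  have "insert x (N \<union> (T - {t})) \<subseteq> ?R" using x \<open>N \<subset> M\<close> by auto
  then have "t \<in> lin_span K L ?R" using t(2) lin_span_mono by blast
  then have "N \<union> T \<subseteq> lin_span K L ?R" using lin_span_superset[of ?R] \<open>N \<subset> M\<close> by auto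
  then have "lin_span K L ?R = carrier L"
    using lin_span_least[OF sub, of "N \<union> T"] T(4) submoduleE(1)[OF sub] by blast
  then have "codim M \<le> card (T - {t})" using T by (intro codim_le) auto
  also have "\<dots> < card T" using T t by (intro card_Diff1_less)
  finally show ?thesis using T by simp
qed

text \<open>Codimensions are bounded by the size of a finite generating set. Among the submodules
  inside \<open>N\<close> with property \<open>P\<close>, one of greatest codimension is minimal,
  because a proper submodule has larger codimension.\<close>

lemma ex_minimal_submodule:
  assumes "fin_dim K L" "P N" "\<And>M. P M \<Longrightarrow> submodule M K L"
  shows "\<exists>M. P M \<and> M \<subseteq> N \<and> (\<forall>B. P B \<and> B \<subseteq> M \<longrightarrow> B = M)"
proof -
  obtain S where S: "finite S" "S \<subseteq> carrier L" "lin_span K L S = carrier L"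
    using \<open>fin_dim K L\<close> unfolding fin_dim_def by blast
  have "codim M \<le> card S" if "P M" for M
    using S lin_span_mono[of S "M \<union> S"] submoduleE(1)[OF submodule_lin_span, of "M \<union> S"]
      submoduleE(1)[OF assms(3)[OF that]] by (intro codim_le) auto
  then have "\<exists>M. (P M \<and> M \<subseteq> N) \<and> (\<forall>B. P B \<and> B \<subseteq> N \<longrightarrow> codim B \<le> codim M)"
    using \<open>P N\<close> by (intro ex_has_greatest_nat[where k = N and b = "Suc (card S)"]) (auto simp: le_Suc_eq less_Suc_eq_le)
  then obtain M where M: "P M" "M \<subseteq> N" "\<And>B. P B \<Longrightarrow> B \<subseteq> N \<Longrightarrow> codim B \<le> codim M" by blast
  have "B = M" if "P B" "B \<subseteq> M" for B
    using codim_less[OF assms(1) assms(3)[OF M(1)] assms(3)[OF that(1)]] M(2) M(3)[OF that(1)] that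
    by (metis leD psubsetI subset_trans)
  then show ?thesis using M by blast
qed

end

section \<open>Ideals, quotients and complements\<close>

locale algebra_over = vspace K L + nonassoc_algebra K L
  for K :: "('c, 'm) ring_scheme" and L :: "('c, 'a) module" (structure)
begin

lemma minus_smult: "x \<in> carrier L \<Longrightarrow> \<ominus> x = (\<ominus>\<^bsub>K\<^esub> \<one>\<^bsub>K\<^esub>) \<odot> x"
  by (simp add: smult_l_minus)

lemma mult_zero_r: "x \<in> carrier L \<Longrightarrow> x \<otimes> \<zero> = \<zero>"
  using mult_smult_r[of "\<zero>\<^bsub>K\<^esub>" x \<zero>] by (simp add: mult_closed)

lemma mult_zero_l: "x \<in> carrier L \<Longrightarrow> \<zero> \<otimes> x = \<zero>"
  using mult_smult_l[of "\<zero>\<^bsub>K\<^esub>" \<zero> x] by (simp add: mult_closed)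

lemma mult_minus_r: "x \<in> carrier L \<Longrightarrow> y \<in> carrier L \<Longrightarrow> x \<otimes> (\<ominus> y) = \<ominus> (x \<otimes> y)"
  by (simp add: minus_smult mult_smult_r mult_closed)

lemma mult_minus_l: "x \<in> carrier L \<Longrightarrow> y \<in> carrier L \<Longrightarrow> (\<ominus> x) \<otimes> y = \<ominus> (x \<otimes> y)"
  by (simp add: minus_smult mult_smult_l mult_closed)

lemma alg_idealD:
  assumes "alg_ideal K L I"
  shows "submodule I K L" "\<And>x a. x \<in> carrier L \<Longrightarrow> a \<in> I \<Longrightarrow> x \<otimes> a \<in> I"
    "\<And>x a. x \<in> carrier L \<Longrightarrow> a \<in> I \<Longrightarrow> a \<otimes> x \<in> I"
  using assms unfolding alg_ideal_def by auto

lemma subalgebraD: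
  assumes "subalgebra K L H"
  shows "submodule H K L" "\<And>x y. x \<in> H \<Longrightarrow> y \<in> H \<Longrightarrow> x \<otimes> y \<in> H"
  using assms unfolding subalgebra_def by auto

lemma subalgebra_carrier: "subalgebra K L (carrier L)"
  unfolding subalgebra_def using carrier_is_submodule mult_closed by auto

lemma subalgebra_zero: "subalgebra K L {\<zero>}"
  unfolding subalgebra_def using submodule_zero mult_zero_r by auto

lemma alg_ideal_zero: "alg_ideal K L {\<zero>}"
  unfolding alg_ideal_def using submodule_zero mult_zero_r mult_zero_l by auto

lemma alg_ideal_carrier: "alg_ideal K L (carrier L)"
  unfolding alg_ideal_def using carrier_is_submodule mult_closed by auto

lemma alg_ideal_Int: "alg_ideal K L I \<Longrightarrow> alg_ideal K L J \<Longrightarrow> alg_ideal K L (I \<inter> J)"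
  unfolding alg_ideal_def using submodule_Int by blast

text \<open>Bilinearity makes both multiplications by \<open>x\<close> linear. Together with
  \<open>lin_span_least\<close> these preimages extend statements about products from generators to
  their span.\<close>

lemma submodule_mult_vimage:
  assumes N: "submodule N K L" and x: "x \<in> carrier L"
  shows "submodule {v \<in> carrier L. x \<otimes> v \<in> N} K L" "submodule {v \<in> carrier L. v \<otimes> x \<in> N} K L"
  using x submodule_zero_mem[OF N] submoduleE(3-5)[OF N]
  by (intro submoduleI; auto simp: mult_zero_l mult_zero_r mult_minus_l mult_minus_r
      mult_l_distr mult_r_distr mult_smult_l mult_smult_r)+

lemma alg_ideal_lin_span:
  assumes S: "S \<subseteq> carrier L"
    and "\<And>x s. x \<in> carrier L \<Longrightarrow> s \<in> S \<Longrightarrow> x \<otimes> s \<in> lin_span K L S \<and> s \<otimes> x \<in> lin_span K L S"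
  shows "alg_ideal K L (lin_span K L S)"
proof -
  have "lin_span K L S \<subseteq> {v \<in> carrier L. x \<otimes> v \<in> lin_span K L S}"
    "lin_span K L S \<subseteq> {v \<in> carrier L. v \<otimes> x \<in> lin_span K L S}"
    if "x \<in> carrier L" for x
    using assms that by (intro lin_span_least submodule_mult_vimage submodule_lin_span; auto)+
  then show ?thesis
    unfolding alg_ideal_def using submodule_lin_span[OF S] by auto
qed

text \<open>Shows that the greatest ideal in the definition of the Frattini ideal exists.\<close>

lemma alg_ideal_eq_zero_if_subset_frattini:
  assumes \<Phi>: "frattini_ideal K L = {\<zero>}"
    and I: "alg_ideal K L I" "I \<subseteq> frattini_subalgebra K L"
  shows "I = {\<zero>}"
proof -
  define \<I> where "\<I> = {J. alg_ideal K L J \<and> J \<subseteq> frattini_subalgebra K L}"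
  define G where "G = lin_span K L (\<Union>\<I>)"
  \<comment> \<open>Inserting the carrier keeps the family nonempty when there is no maximal
    subalgebra.\<close>
  have "submodule (\<Inter>(insert (carrier L) {M. maximal_subalgebra K L M})) K L"
    by (rule submodule_Inter)
      (auto simp: carrier_is_submodule maximal_subalgebra_def subalgebra_def)
  then have frat: "submodule (frattini_subalgebra K L) K L"
    unfolding frattini_subalgebra_def by simp
  have "\<Union>\<I> \<subseteq> carrier L"
    unfolding \<I>_def frattini_subalgebra_def by auto
  then have ideal: "alg_ideal K L G"
    unfolding G_def using lin_span_superset[of "\<Union>\<I>"]
    by (intro alg_ideal_lin_span) (auto simp: \<I>_def dest: alg_idealD)
  have "G \<subseteq> frattini_subalgebra K L"
    unfolding G_def by (intro lin_span_least frat) (auto simp: \<I>_def)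
  moreover have upper: "J \<subseteq> G" if "J \<in> \<I>" for J
    using that lin_span_superset[of "\<Union>\<I>"] unfolding G_def by blast
  ultimately have "frattini_ideal K L = G"
    unfolding frattini_ideal_def using ideal by (intro Greatest_equality) (auto simp: \<I>_def)
  then have "I \<subseteq> {\<zero>}" using upper[of I] I \<Phi> by (auto simp: \<I>_def)
  then show ?thesis using submodule_zero_mem[OF alg_idealD(1)[OF I(1)]] by auto
qed

text \<open>In \<open>(a \<oplus> m) \<otimes> (b \<oplus> n)\<close> every term except
  \<open>m \<otimes> n\<close> has a factor in the ideal \<open>A\<close>.\<close>

lemma subalgebra_set_add:
  assumes A: "alg_ideal K L A" and M: "subalgebra K L M"
  shows "subalgebra K L (A <+> M)"
  unfolding subalgebra_def
proof (intro conjI ballI)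
  note A' = alg_idealD[OF A] and M' = subalgebraD[OF M]
  note s = submodule_subset[OF A'(1)] submodule_subset[OF M'(1)]
  show "submodule (A <+> M) K L" using A' M' by (intro submodule_set_add)
  fix x y assume "x \<in> A <+> M" "y \<in> A <+> M"
  then obtain a m b n where x: "a \<in> A" "m \<in> M" "x = a \<oplus> m" and y: "b \<in> A" "n \<in> M" "y = b \<oplus> n"
    by (auto simp: mem_set_add)
  have c: "a \<in> carrier L" "m \<in> carrier L" "b \<in> carrier L" "n \<in> carrier L" using x y s by auto
  then have "x \<otimes> y = (a \<otimes> (b \<oplus> n) \<oplus> m \<otimes> b) \<oplus> m \<otimes> n"
    unfolding x y by (simp add: mult_l_distr mult_r_distr mult_closed M.a_ac)
  moreover have "a \<otimes> (b \<oplus> n) \<oplus> m \<otimes> b \<in> A"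
    using c x y by (intro submoduleE(5)[OF A'(1)] A'(2,3)) auto
  moreover have "m \<otimes> n \<in> M" using x y M' by auto
  ultimately show "x \<otimes> y \<in> A <+> M" by (auto simp: mem_set_add)
qed

text \<open>By distributivity the ideal property can be tested on \<open>A\<close> and
  \<open>H\<close> separately. In each application the products of \<open>A\<close> with
  \<open>N\<close> vanish, and those with \<open>H\<close> stay in \<open>N\<close> because
  \<open>N\<close> is an ideal intersected with the subalgebra \<open>H\<close>.\<close>

lemma alg_ideal_of_complement:
  assumes A: "A \<subseteq> carrier L" and H: "H \<subseteq> carrier L" and L: "carrier L = A <+> H"
    and N: "submodule N K L"
    and AN: "\<And>a n. a \<in> A \<Longrightarrow> n \<in> N \<Longrightarrow> a \<otimes> n \<in> N \<and> n \<otimes> a \<in> N"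
    and HN: "\<And>h n. h \<in> H \<Longrightarrow> n \<in> N \<Longrightarrow> h \<otimes> n \<in> N \<and> n \<otimes> h \<in> N"
  shows "alg_ideal K L N"
  unfolding alg_ideal_def
proof (intro conjI ballI N)
  fix x n assume "x \<in> carrier L" and n: "n \<in> N"
  then obtain a h where x: "a \<in> A" "h \<in> H" "x = a \<oplus> h" using L by (auto simp: mem_set_add)
  have c: "a \<in> carrier L" "h \<in> carrier L" "n \<in> carrier L"
    using x n A H submodule_subset[OF N] by auto
  have "x \<otimes> n = a \<otimes> n \<oplus> h \<otimes> n" "n \<otimes> x = n \<otimes> a \<oplus> n \<otimes> h"
    unfolding x(3) using c by (simp_all add: mult_l_distr mult_r_distr)
  then show "x \<otimes> n \<in> N" "n \<otimes> x \<in> N"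
    using AN[OF x(1) n] HN[OF x(2) n] submoduleE(5)[OF N] by auto
qed

section \<open>Cosets, quotient algebras and isomorphisms\<close>

lemma mem_coset: "y \<in> I +> x \<longleftrightarrow> (\<exists>i\<in>I. y = i \<oplus> x)"
  by (auto simp: a_r_coset_def')

lemma abelian_subgroup_submodule: "submodule I K L \<Longrightarrow> abelian_subgroup I L"
  by (intro abelian_subgroupI3 additive_subgroupI submodule.axioms(1) M.abelian_group_axioms)

lemma coset_eq:
  assumes "submodule I K L" "y \<in> I +> x" "x \<in> carrier L"
  shows "I +> x = I +> y"
  using abelian_subgroup.a_repr_independence'[OF abelian_subgroup_submodule] assms by blast

lemma self_mem_coset:
  assumes "submodule I K L" "x \<in> carrier L"
  shows "x \<in> I +> x"
  using abelian_subgroup.a_rcos_self[OF abelian_subgroup_submodule] assms by blast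

lemma quotient_algebra_simps:
  "carrier (quotient_algebra L I) = (+>) I ` carrier L"
  "mult (quotient_algebra L I) = rcoset_mult L I"
  "add (quotient_algebra L I) = set_add L"
  "smult (quotient_algebra L I) = (\<lambda>c X. \<Union>x\<in>X. I +> (c \<odot> x))"
  by (auto simp: quotient_algebra_def ring.defs module.defs FactRing_def A_RCOSETS_def')

text \<open>Product and scalar action on the quotient are unions over representatives. Changing
  representatives by elements of \<open>I\<close> changes the result by an element of
  \<open>I\<close>, so each union runs over equal cosets, and it is nonempty by
  \<open>self_mem_coset\<close>.\<close>

lemma coset_alg_hom:
  assumes I: "alg_ideal K L I"
  shows "(+>) I \<in> alg_hom K L (quotient_algebra L I)"
proof -
  note I' = alg_idealD[OF I]
  note s = submodule_subset[OF I'(1)]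
  have mult: "rcoset_mult L I (I +> x) (I +> y) = I +> (x \<otimes> y)"
    if xy: "x \<in> carrier L" "y \<in> carrier L" for x y
  proof -
    have "I +> (a \<otimes> b) = I +> (x \<otimes> y)" if ab: "a \<in> I +> x" "b \<in> I +> y" for a b
    proof -
      obtain i j where i: "i \<in> I" "a = i \<oplus> x" and j: "j \<in> I" "b = j \<oplus> y"
        using ab by (auto simp: mem_coset)
      have "a \<otimes> b = (i \<otimes> (j \<oplus> y) \<oplus> x \<otimes> j) \<oplus> x \<otimes> y"
        unfolding i j using xy s i j
        by (simp add: mult_l_distr mult_r_distr mult_closed M.a_ac)
      moreover have "i \<otimes> (j \<oplus> y) \<oplus> x \<otimes> j \<in> I"
        using xy s i j by (intro submoduleE(5)[OF I'(1)] I'(2,3)) auto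
      ultimately have "a \<otimes> b \<in> I +> (x \<otimes> y)" by (auto simp: mem_coset)
      then show ?thesis using coset_eq[OF I'(1)] xy mult_closed by auto
    qed
    then show ?thesis
      unfolding rcoset_mult_def using self_mem_coset[OF I'(1)] xy by blast
  qed
  have smult: "(\<Union>a\<in>I +> x. I +> (c \<odot> a)) = I +> (c \<odot> x)"
    if c: "c \<in> carrier K" and x: "x \<in> carrier L" for c x
  proof -
    have "I +> (c \<odot> a) = I +> (c \<odot> x)" if a: "a \<in> I +> x" for a
    proof -
      obtain i where i: "i \<in> I" "a = i \<oplus> x" using a by (auto simp: mem_coset)
      have "c \<odot> a = c \<odot> i \<oplus> c \<odot> x" unfolding i using c x i s by (simp add: smult_r_distr)
      then have "c \<odot> a \<in> I +> (c \<odot> x)"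
        using submoduleE(4)[OF I'(1)] c i by (auto simp: mem_coset)
      then show ?thesis using coset_eq[OF I'(1)] c x by auto
    qed
    then show ?thesis using self_mem_coset[OF I'(1)] x by blast
  qed
  show ?thesis
    unfolding alg_hom_def quotient_algebra_simps
    using mult smult abelian_subgroup.a_rcos_sum[OF abelian_subgroup_submodule[OF I'(1)]]
    by auto
qed

text \<open>The difference \<open>i\<close> of the two \<open>A\<close>-parts equals a difference of
  the two \<open>H\<close>-parts, hence lies in \<open>A \<inter> H\<close>.\<close>

lemma complement_unique:
  assumes A: "submodule A K L" and H: "submodule H K L" and AH: "A \<inter> H = {\<zero>}"
    and ab: "a \<in> A" "b \<in> A" and hk: "h \<in> H" "k \<in> H" and eq: "a \<oplus> h = b \<oplus> k"
  shows "a = b" "h = k"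
proof -
  have c: "a \<in> carrier L" "b \<in> carrier L" "h \<in> carrier L" "k \<in> carrier L"
    using ab hk submodule_subset[OF A] submodule_subset[OF H] by auto
  define i where "i = \<ominus> b \<oplus> a"
  have i: "i \<in> A" unfolding i_def using ab submoduleE(3,5)[OF A] by blast
  then have ic: "i \<in> carrier L" using submodule_subset[OF A] by blast
  have "i \<oplus> h = \<ominus> b \<oplus> (b \<oplus> k)" unfolding i_def eq[symmetric] using c by (simp add: M.a_assoc)
  then have k: "k = h \<oplus> i" using c ic by (simp add: M.r_neg1 M.a_comm)
  then have "i \<in> H" using submodule_add_left_cancel[OF H hk(1) ic] hk(2) by simp
  then have "i = \<zero>" using i AH by blast
  then show "h = k" using k c by simp
  then show "a = b" using eq c by simp
qed

text \<open>The isomorphism is the quotient map restricted to \<open>H\<close>: injective because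
  \<open>I \<inter> H\<close> is zero, surjective because \<open>I\<close> and \<open>H\<close>
  together span \<open>L\<close>.\<close>

lemma alg_isomorphic_complement_quotient:
  assumes I: "alg_ideal K L I" and H: "complementing_subalgebra K L I H"
  shows "alg_isomorphic K (L\<lparr>carrier := H\<rparr>) (quotient_algebra L I)"
proof -
  note I' = alg_idealD(1)[OF I]
  have H': "submodule H K L" "carrier L = I <+> H" "I \<inter> H = {\<zero>}"
    using H unfolding complementing_subalgebra_def subalgebra_def by auto
  note s = submodule_subset[OF I'] submodule_subset[OF H'(1)]
  have "(+>) I \<in> alg_hom K (L\<lparr>carrier := H\<rparr>) (quotient_algebra L I)"
    using coset_alg_hom[OF I] s(2) unfolding alg_hom_def by auto
  moreover have "inj_on ((+>) I) H"
  proof (rule inj_onI)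
    fix h k assume hk: "h \<in> H" "k \<in> H" "I +> h = I +> k"
    then obtain i where i: "i \<in> I" "h = i \<oplus> k"
      using self_mem_coset[OF I', of h] s by (auto simp: mem_coset)
    then have "\<zero> \<oplus> h = i \<oplus> k" using hk s by simp
    then show "h = k"
      using complement_unique(2)[OF I' H'(1,3)] submodule_zero_mem[OF I'] i(1) hk by blast
  qed
  moreover have "(+>) I ` H = (+>) I ` carrier L"
  proof (intro subset_antisym image_subsetI)
    show "I +> h \<in> (+>) I ` carrier L" if "h \<in> H" for h using that s by auto
    show "I +> x \<in> (+>) I ` H" if x: "x \<in> carrier L" for x
    proof -
      obtain i h where "i \<in> I" "h \<in> H" "x = i \<oplus> h"
        using x H'(2) by (auto simp: mem_set_add)
      then have "I +> h = I +> x" using coset_eq[OF I', of x h] s by (auto simp: mem_coset)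
      then show ?thesis using \<open>h \<in> H\<close> by auto
    qed
  qed
  ultimately show ?thesis
    unfolding alg_isomorphic_def bij_betw_def by (auto simp: quotient_algebra_simps)
qed

text \<open>The whole algebra complements the zero ideal, so this is a special case of the preceding
  isomorphism.\<close>

lemma alg_isomorphic_quotient_zero: "alg_isomorphic K L (quotient_algebra L {\<zero>})"
proof -
  have "carrier L = {\<zero>} <+> carrier L" by (force simp: mem_set_add set_eq_iff)
  then have "complementing_subalgebra K L {\<zero>} (carrier L)"
    unfolding complementing_subalgebra_def using subalgebra_carrier by auto
  from alg_isomorphic_complement_quotient[OF alg_ideal_zero this] show ?thesis by simp
qed

text \<open>Every element of \<open>Y\<close> is an \<open>f x\<close>, so the operations of
  \<open>Y\<close> can be computed in \<open>L\<close>. The algebra axioms are thus used on the side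
  of \<open>L\<close> only, and a quotient can be taken for \<open>Y\<close> directly.\<close>

lemma alg_isomorphic_sym:
  assumes "alg_isomorphic K L Y"
  shows "alg_isomorphic K Y L"
proof -
  obtain f where f: "f \<in> alg_hom K L Y" "bij_betw f (carrier L) (carrier Y)"
    using assms unfolding alg_isomorphic_def by blast
  define g where "g = inv_into (carrier L) f"
  have g: "bij_betw g (carrier Y) (carrier L)" unfolding g_def by (rule bij_betw_inv_into[OF f(2)])
  have gf: "g (f x) = x" if "x \<in> carrier L" for x
    using that f(2) unfolding g_def by (simp add: bij_betw_inv_into_left)
  have im: "carrier Y = f ` carrier L" using f(2) unfolding bij_betw_def by auto
  have fhom: "f x \<oplus>\<^bsub>Y\<^esub> f y = f (x \<oplus> y)" "f x \<otimes>\<^bsub>Y\<^esub> f y = f (x \<otimes> y)" "c \<odot>\<^bsub>Y\<^esub> f x = f (c \<odot> x)"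
    if "x \<in> carrier L" "y \<in> carrier L" "c \<in> carrier K" for x y c
    using that f(1) unfolding alg_hom_def by auto
  \<comment> \<open>The laws in \<open>fhom\<close> share their premises: a zero scalar fills the
    gap in the laws for sum and product, a zero vector the one in the law for scalars.\<close>
  have "g \<in> alg_hom K Y L"
    unfolding alg_hom_def im using fhom[OF _ _ K.zero_closed] fhom(3)[OF _ M.zero_closed] gf
    by (auto simp: mult_closed)
  then show ?thesis using g unfolding alg_isomorphic_def by blast
qed

end

lemma alg_isomorphic_trans:
  assumes "alg_isomorphic K X Y" "alg_isomorphic K Y Z"
  shows "alg_isomorphic K X Z"
proof -
  obtain f where f: "f \<in> alg_hom K X Y" "bij_betw f (carrier X) (carrier Y)"
    using assms(1) unfolding alg_isomorphic_def by blast
  obtain g where g: "g \<in> alg_hom K Y Z" "bij_betw g (carrier Y) (carrier Z)"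
    using assms(2) unfolding alg_isomorphic_def by blast
  have "g \<circ> f \<in> alg_hom K X Z"
    using f(1) g(1) unfolding alg_hom_def by (auto simp: Pi_iff)
  then show ?thesis
    using bij_betw_trans[OF f(2) g(2)] unfolding alg_isomorphic_def by blast
qed

section \<open>Leibniz algebras\<close>

locale leibniz_alg = algebra_over K L + leibniz_algebra K L
  for K :: "('c, 'm) ring_scheme" and L :: "('c, 'a) module" (structure)
begin

text \<open>The Leibniz identity solved for the left-bracketed product: left multiplication by
  \<open>x \<otimes> y\<close> is the commutator of the left multiplications by \<open>x\<close> and
  \<open>y\<close>.\<close>

lemma mult_assoc_left:
  assumes "x \<in> carrier L" "y \<in> carrier L" "z \<in> carrier L"
  shows "(x \<otimes> y) \<otimes> z = x \<otimes> (y \<otimes> z) \<ominus> y \<otimes> (x \<otimes> z)"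
  unfolding leibniz[OF assms] using assms by (simp add: a_minus_def mult_closed M.a_assoc M.r_neg)

text \<open>Left multiplication by \<open>x\<close> is a derivation, which handles
  \<open>x \<otimes> (a \<otimes> b)\<close>. For \<open>(a \<otimes> b) \<otimes> x\<close> the
  commutator form \<open>mult_assoc_left\<close> again leaves only products of two elements of
  \<open>A\<close>.\<close>

lemma alg_ideal_mult:
  assumes A: "alg_ideal K L A"
  shows "alg_ideal K L (lin_span K L {a \<otimes> b | a b. a \<in> A \<and> b \<in> A})" (is "alg_ideal K L (lin_span K L ?S)")
proof (rule alg_ideal_lin_span)
  note A' = alg_idealD[OF A]
  note s = submodule_subset[OF A'(1)]
  show S: "?S \<subseteq> carrier L" using s mult_closed by auto
  note sub = submodule_lin_span[OF S]
  have mem: "a \<otimes> b \<in> lin_span K L ?S" if "a \<in> A" "b \<in> A" for a b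
    using that lin_span_superset[of ?S] by blast
  fix x v assume x: "x \<in> carrier L" and "v \<in> ?S"
  then obtain a b where ab: "a \<in> A" "b \<in> A" "v = a \<otimes> b" by auto
  have "x \<otimes> v = (x \<otimes> a) \<otimes> b \<oplus> a \<otimes> (x \<otimes> b)" "v \<otimes> x = a \<otimes> (b \<otimes> x) \<ominus> b \<otimes> (a \<otimes> x)"
    unfolding ab(3) using x ab(1,2) s by (blast intro: leibniz mult_assoc_left)+
  then show "x \<otimes> v \<in> lin_span K L ?S \<and> v \<otimes> x \<in> lin_span K L ?S"
    using x ab A' mem submoduleE(5)[OF sub] submodule_minus_mem[OF sub] by auto
qed

text \<open>The span of the products of \<open>A\<close> with itself is an ideal inside
  \<open>A\<close>, hence zero or \<open>A\<close>. In the second case \<open>A\<close> would lie in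
  every term of the derived series, against solvability.\<close>

lemma minimal_ideal_abelian:
  assumes "solvable_algebra K L" and "minimal_ideal K L A" and "a \<in> A" "b \<in> A"
  shows "a \<otimes> b = \<zero>"
proof -
  let ?S = "{a \<otimes> b | a b. a \<in> A \<and> b \<in> A}"
  have A: "alg_ideal K L A" "A \<noteq> {\<zero>}"
    and min: "\<And>B. alg_ideal K L B \<Longrightarrow> B \<subseteq> A \<Longrightarrow> B = {\<zero>} \<or> B = A"
    using assms(2) unfolding minimal_ideal_def by auto
  note A' = alg_idealD[OF A(1)]
  have "lin_span K L ?S \<subseteq> A"
    using A' submodule_subset[OF A'(1)] by (intro lin_span_least) auto
  then have "lin_span K L ?S = {\<zero>} \<or> lin_span K L ?S = A"
    using min alg_ideal_mult[OF A(1)] by blast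
  then show ?thesis
  proof
    assume "lin_span K L ?S = {\<zero>}"
    then show ?thesis using lin_span_superset[of ?S] assms(3,4) by auto
  next
    assume perfect: "lin_span K L ?S = A"
    have "A \<subseteq> derived_ser K L n" for n
    proof (induction n)
      case 0
      then show ?case using submoduleE(1)[OF A'(1)] by simp
    next
      case (Suc n)
      then have "lin_span K L ?S \<subseteq> derived_ser K L (Suc n)"
        unfolding derived_ser.simps by (intro lin_span_mono) blast
      then show ?case using perfect by simp
    qed
    then have "A \<subseteq> {\<zero>}" using assms(1) unfolding solvable_algebra_def by metis
    then show ?thesis using A(2) submodule_zero_mem[OF A'(1)] by auto
  qed
qed

text \<open>Some maximal subalgebra \<open>M\<close> does not contain \<open>A\<close>, and
  maximality gives \<open>A <+> M = carrier L\<close>. As \<open>A\<close> is abelian it annihilates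
  \<open>A \<inter> M\<close>, which is therefore an ideal of \<open>L\<close>, and minimality of
  \<open>A\<close> makes it zero.\<close>

lemma complement_of_minimal_ideal:
  assumes "solvable_algebra K L" and "frattini_ideal K L = {\<zero>}" and min: "minimal_ideal K L A"
  obtains M where "complementing_subalgebra K L A M" "M \<noteq> carrier L"
proof -
  have A: "alg_ideal K L A" "A \<noteq> {\<zero>}" using min unfolding minimal_ideal_def by auto
  note A' = alg_idealD[OF A(1)]
  have "\<not> A \<subseteq> frattini_subalgebra K L"
    using alg_ideal_eq_zero_if_subset_frattini[OF assms(2) A(1)] A(2) by blast
  then obtain M where "maximal_subalgebra K L M" and not: "\<not> A \<subseteq> M"
    using submoduleE(1)[OF A'(1)] unfolding frattini_subalgebra_def by blast
  then have M: "subalgebra K L M" "M \<noteq> carrier L"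
    and max: "\<And>N. subalgebra K L N \<Longrightarrow> M \<subseteq> N \<Longrightarrow> N = M \<or> N = carrier L"
    unfolding maximal_subalgebra_def by auto
  note M' = subalgebraD[OF M(1)]
  have L: "A <+> M = carrier L"
    using max[OF subalgebra_set_add[OF A(1) M(1)]] not subset_set_add[OF A'(1) M'(1)] by blast
  have zero: "\<zero> \<in> A \<inter> M" using submodule_zero_mem A'(1) M'(1) by auto
  have "alg_ideal K L (A \<inter> M)"
  proof (rule alg_ideal_of_complement[OF _ _ L[symmetric]])
    show "A \<subseteq> carrier L" "M \<subseteq> carrier L" "submodule (A \<inter> M) K L"
      using submoduleE(1) submodule_Int A'(1) M'(1) by auto
    show "a \<otimes> n \<in> A \<inter> M \<and> n \<otimes> a \<in> A \<inter> M" if "a \<in> A" "n \<in> A \<inter> M" for a n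
      using minimal_ideal_abelian[OF assms(1) min] that zero by auto
    show "h \<otimes> n \<in> A \<inter> M \<and> n \<otimes> h \<in> A \<inter> M" if "h \<in> M" "n \<in> A \<inter> M" for h n
      using that M' A' submodule_subset[OF M'(1)] by auto
  qed
  then have "A \<inter> M = {\<zero>} \<or> A \<inter> M = A" using min unfolding minimal_ideal_def by blast
  then have "complementing_subalgebra K L A M"
    unfolding complementing_subalgebra_def using L M(1) not by auto
  then show thesis using that M(2) by blast
qed

lemma ex_minimal_ideal:
  assumes "fin_dim K L" "alg_ideal K L I" "I \<noteq> {\<zero>}"
  obtains A where "minimal_ideal K L A" "A \<subseteq> I"
proof -
  let ?P = "\<lambda>B. alg_ideal K L B \<and> B \<noteq> {\<zero>}"
  have "\<exists>M. ?P M \<and> M \<subseteq> I \<and> (\<forall>B. ?P B \<and> B \<subseteq> M \<longrightarrow> B = M)"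
    by (rule ex_minimal_submodule[where P = ?P]) (use assms alg_idealD(1) in auto)
  then obtain M where M: "?P M \<and> M \<subseteq> I \<and> (\<forall>B. ?P B \<and> B \<subseteq> M \<longrightarrow> B = M)" ..
  then have "minimal_ideal K L M" unfolding minimal_ideal_def by auto
  then show thesis using that M by simp
qed

section \<open>The ideal \<open>leib K L\<close> and the centralizer of an ideal\<close>

lemma squares_subset_carrier: "{x \<otimes> x | x. x \<in> carrier L} \<subseteq> carrier L"
  using mult_closed by auto

lemma square_mem_leib: "x \<in> carrier L \<Longrightarrow> x \<otimes> x \<in> leib K L"
  unfolding leib_def using lin_span_superset[of "{x \<otimes> x | x. x \<in> carrier L}"] by blast

lemma submodule_leib: "submodule (leib K L) K L"
  unfolding leib_def by (rule submodule_lin_span[OF squares_subset_carrier])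

text \<open>For a square, \<open>(x \<otimes> x) \<otimes> y\<close> is the commutator of left
  multiplication by \<open>x\<close> with itself, applied to \<open>y\<close>. The property passes
  to the span.\<close>

lemma leib_mult:
  assumes "x \<in> leib K L" "y \<in> carrier L"
  shows "x \<otimes> y = \<zero>"
proof -
  have "leib K L \<subseteq> {v \<in> carrier L. v \<otimes> y \<in> {\<zero>}}"
    unfolding leib_def using assms(2)
    by (intro lin_span_least submodule_mult_vimage submodule_zero)
      (auto simp: mult_closed mult_assoc_left a_minus_def M.r_neg)
  then show ?thesis using assms(1) by auto
qed

text \<open>With \<open>z = x \<otimes> y\<close> the Leibniz identity turns
  \<open>x \<otimes> (y \<otimes> y)\<close> into
  \<open>z \<otimes> y \<oplus> y \<otimes> z\<close>. By polarization this is the square of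
  \<open>z \<oplus> y\<close> minus the squares of \<open>z\<close> and \<open>y\<close>. Products
  in the other order vanish by \<open>leib_mult\<close>.\<close>

lemma alg_ideal_leib: "alg_ideal K L (leib K L)"
  unfolding leib_def
proof (rule alg_ideal_lin_span[OF squares_subset_carrier], fold leib_def)
  fix x s assume x: "x \<in> carrier L" and "s \<in> {x \<otimes> x | x. x \<in> carrier L}"
  then obtain y where y: "y \<in> carrier L" "s = y \<otimes> y" by auto
  define z where "z = x \<otimes> y"
  have z: "z \<in> carrier L" using x y by (simp add: z_def mult_closed)
  have "(z \<oplus> y) \<otimes> (z \<oplus> y) = (z \<otimes> z \<oplus> y \<otimes> y) \<oplus> (z \<otimes> y \<oplus> y \<otimes> z)"
    using y z by (simp add: mult_l_distr mult_r_distr mult_closed M.a_ac)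
  then have "(z \<otimes> z \<oplus> y \<otimes> y) \<oplus> (z \<otimes> y \<oplus> y \<otimes> z) \<in> leib K L"
    using square_mem_leib[of "z \<oplus> y"] y z by simp
  then have "z \<otimes> y \<oplus> y \<otimes> z \<in> leib K L"
  proof (rule submodule_add_left_cancel[OF submodule_leib, rotated -1])
    show "z \<otimes> z \<oplus> y \<otimes> y \<in> leib K L"
      by (rule submoduleE(5)[OF submodule_leib square_mem_leib[OF z] square_mem_leib[OF y(1)]])
    show "z \<otimes> y \<oplus> y \<otimes> z \<in> carrier L" using y z by (simp add: mult_closed)
  qed
  then have "x \<otimes> s \<in> leib K L" unfolding y(2) z_def using leibniz[OF x y(1) y(1)] by simp
  moreover have "s \<otimes> x = \<zero>" using x y by (simp add: leib_mult square_mem_leib)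
  ultimately show "x \<otimes> s \<in> leib K L \<and> s \<otimes> x \<in> leib K L"
    using submodule_zero_mem[OF submodule_leib] by simp
qed

text \<open>After rebracketing, each term of a product of \<open>x\<close>, \<open>z\<close> and
  \<open>a\<close> contains \<open>z\<close> multiplied by an element of \<open>A\<close>, since
  \<open>A\<close> absorbs \<open>x\<close>.\<close>

lemma alg_ideal_centralizer:
  assumes A: "alg_ideal K L A"
  shows "alg_ideal K L (alg_centralizer L A)"
proof -
  note A' = alg_idealD[OF A]
  note s = submodule_subset[OF A'(1)]
  have "submodule (alg_centralizer L A) K L"
    unfolding alg_centralizer_def using s
    by (intro submoduleI) (auto simp: mult_zero_l mult_zero_r mult_minus_l mult_minus_r
        mult_l_distr mult_r_distr mult_smult_l mult_smult_r)
  moreover have "x \<otimes> z \<in> alg_centralizer L A \<and> z \<otimes> x \<in> alg_centralizer L A"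
    if x: "x \<in> carrier L" and z: "z \<in> alg_centralizer L A" for x z
  proof -
    have zc: "z \<in> carrier L" and za: "\<And>a. a \<in> A \<Longrightarrow> z \<otimes> a = \<zero> \<and> a \<otimes> z = \<zero>"
      using z unfolding alg_centralizer_def by auto
    have "(x \<otimes> z) \<otimes> a = \<zero>" "(z \<otimes> x) \<otimes> a = \<zero>" if "a \<in> A" for a
      using that x zc s za A' by (simp_all add: mult_assoc_left mult_zero_r a_minus_def)
    moreover have "a \<otimes> (x \<otimes> z) = \<zero>" "a \<otimes> (z \<otimes> x) = \<zero>" if "a \<in> A" for a
      using that x zc s za A' by (simp_all add: leibniz[of a] mult_zero_r mult_zero_l)
    ultimately show ?thesis using x zc unfolding alg_centralizer_def by (auto simp: mult_closed)
  qed
  ultimately show ?thesis unfolding alg_ideal_def by auto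
qed

end

section \<open>The companion Lie algebra\<close>

text \<open>The module axioms speak of addition, zero and scalars only. This carries the module
  structure of \<open>L\<close> over to its companion.\<close>

lemma module_mult_update: "module K L \<Longrightarrow> module K (L\<lparr>mult := f\<rparr>)"
  unfolding module_def abelian_group_def abelian_monoid_def abelian_group_axioms_def
    module_axioms_def
  by simp

context leibniz_alg
begin

lemma lie_algebra_subalgebra:
  assumes H: "subalgebra K L H" and "\<And>h. h \<in> H \<Longrightarrow> h \<otimes> h = \<zero>"
  shows "lie_algebra K (L\<lparr>carrier := H\<rparr>)"
proof -
  note H' = subalgebraD[OF H]
  note s = submodule_subset[OF H'(1)]
  have "module K (L\<lparr>carrier := H\<rparr>)"
    using submodule.submodule_is_module[OF H'(1) L.module_axioms] .
  then show ?thesis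
    using assms(2) H' s
    by (intro lie_algebra.intro leibniz_algebra.intro nonassoc_algebra.intro K.field_axioms
        lie_algebra_axioms.intro leibniz_algebra_axioms.intro nonassoc_algebra_axioms.intro)
      (auto simp: mult_l_distr mult_r_distr mult_smult_l mult_smult_r intro: leibniz)
qed

text \<open>Uniqueness of decompositions gives the definite description in \<open>companion\<close>
  exactly one solution, so the bracket can be computed from any given summands.\<close>

lemma companion_mult:
  assumes A: "submodule A K L" and H: "submodule H K L" and AH: "A \<inter> H = {\<zero>}"
    and "a \<in> A" "b \<in> A" "h \<in> H" "k \<in> H"
  shows "(a \<oplus> h) \<otimes>\<^bsub>companion L A H\<^esub> (b \<oplus> k) = (h \<otimes> b \<ominus> k \<otimes> a) \<oplus> h \<otimes> k"
proof -
  have "z = (h \<otimes> b \<ominus> k \<otimes> a) \<oplus> h \<otimes> k"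
    if "\<exists>a'\<in>A. \<exists>b'\<in>A. \<exists>h'\<in>H. \<exists>k'\<in>H. a \<oplus> h = a' \<oplus> h' \<and> b \<oplus> k = b' \<oplus> k' \<and>
      z = (h' \<otimes> b' \<ominus> k' \<otimes> a') \<oplus> h' \<otimes> k'" for z
    using that complement_unique[OF A H AH] assms(4-7) by metis
  then show ?thesis
    unfolding companion_def using assms(4-7) by (simp, intro the_equality) auto
qed

text \<open>The companion is the semidirect product of the Lie algebra \<open>H\<close> with
  \<open>A\<close>, made abelian, on which \<open>H\<close> acts by left multiplication. This action
  is a representation because of \<open>mult_assoc_left\<close>.\<close>

lemma lie_algebra_companion:
  assumes A: "alg_ideal K L A" and comp: "complementing_subalgebra K L A H"
    and sq: "\<And>h. h \<in> H \<Longrightarrow> h \<otimes> h = \<zero>"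
  shows "lie_algebra K (companion L A H)" (is "lie_algebra K ?C")
proof -
  note A' = alg_idealD[OF A]
  have H: "subalgebra K L H" and L: "carrier L = A <+> H" and AH: "A \<inter> H = {\<zero>}"
    using comp unfolding complementing_subalgebra_def by auto
  note H' = subalgebraD[OF H]
  note s = submodule_subset[OF A'(1)] submodule_subset[OF H'(1)]
  note cm = companion_mult[OF A'(1) H'(1) AH]
  have simps: "carrier ?C = carrier L" "add ?C = add L" "zero ?C = zero L" "smult ?C = smult L"
    unfolding companion_def L by simp_all
  have decomp: "\<exists>a h. a \<in> A \<and> h \<in> H \<and> a \<in> carrier L \<and> h \<in> carrier L \<and> x = a \<oplus> h"
    if "x \<in> carrier L" for x
    using that[unfolded L mem_set_add] s by metis
  \<comment> \<open>The value of a bracket is again an \<open>A\<close>-part plus an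
    \<open>H\<close>-part, so \<open>cm\<close> also evaluates nested brackets.\<close>
  have memA: "h \<otimes> b \<ominus> k \<otimes> a \<in> A" if "a \<in> A" "b \<in> A" "h \<in> H" "k \<in> H" for a b h k
    using that s by (intro submodule_minus_mem[OF A'(1)] A'(2))
  note memH = H'(2)
  note add = submoduleE(5)[OF A'(1)] submoduleE(5)[OF H'(1)]
  note scale = submoduleE(4)[OF A'(1)] submoduleE(4)[OF H'(1)]
  note norm = a_minus_def mult_l_distr mult_r_distr mult_smult_l mult_smult_r mult_minus_l
    mult_minus_r smult_r_distr smult_r_minus mult_closed M.minus_add
  have "module K ?C"
    using module_mult_update[OF L.module_axioms] unfolding companion_def L[symmetric] by simp
  moreover have "nonassoc_algebra_axioms K ?C"
  proof (unfold_locales, unfold simps)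
    fix x y assume "x \<in> carrier L" "y \<in> carrier L"
    then obtain a h b k where x: "a \<in> A" "h \<in> H" "a \<in> carrier L" "h \<in> carrier L" "x = a \<oplus> h"
      and y: "b \<in> A" "k \<in> H" "b \<in> carrier L" "k \<in> carrier L" "y = b \<oplus> k"
      using decomp by metis
    show "x \<otimes>\<^bsub>?C\<^esub> y \<in> carrier L"
      using x y by (simp add: cm mult_closed)
    show "(c \<odot> x) \<otimes>\<^bsub>?C\<^esub> y = c \<odot> (x \<otimes>\<^bsub>?C\<^esub> y)" if c: "c \<in> carrier K" for c
    proof -
      have "c \<odot> x = c \<odot> a \<oplus> c \<odot> h" using x c by (simp add: smult_r_distr)
      then show ?thesis using x y c scale by (simp add: cm norm)
    qed
    show "x \<otimes>\<^bsub>?C\<^esub> (c \<odot> y) = c \<odot> (x \<otimes>\<^bsub>?C\<^esub> y)" if c: "c \<in> carrier K" for c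
    proof -
      have "c \<odot> y = c \<odot> b \<oplus> c \<odot> k" using y c by (simp add: smult_r_distr)
      then show ?thesis using x y c scale by (simp add: cm norm)
    qed
    fix z assume "z \<in> carrier L"
    then obtain c l where z: "c \<in> A" "l \<in> H" "c \<in> carrier L" "l \<in> carrier L" "z = c \<oplus> l"
      using decomp by metis
    \<comment> \<open>The sum is regrouped to match \<open>cm\<close>. Brackets are evaluated before
      sorting with \<open>M.a_ac\<close>, which would undo the grouping.\<close>
    have "x \<oplus> y = (a \<oplus> b) \<oplus> (h \<oplus> k)" using x y by (simp add: add_interchange)
    then show "(x \<oplus> y) \<otimes>\<^bsub>?C\<^esub> z = x \<otimes>\<^bsub>?C\<^esub> z \<oplus> y \<otimes>\<^bsub>?C\<^esub> z"
      using x y z add by (simp add: cm) (simp add: norm M.a_ac)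
    have "y \<oplus> z = (b \<oplus> c) \<oplus> (k \<oplus> l)" using y z by (simp add: add_interchange)
    then show "x \<otimes>\<^bsub>?C\<^esub> (y \<oplus> z) = x \<otimes>\<^bsub>?C\<^esub> y \<oplus> x \<otimes>\<^bsub>?C\<^esub> z"
      using x y z add by (simp add: cm) (simp add: norm M.a_ac)
  qed
  moreover have "leibniz_algebra_axioms ?C"
  proof (rule leibniz_algebra_axioms.intro, unfold simps)
    fix x y z assume xyz: "x \<in> carrier L" "y \<in> carrier L" "z \<in> carrier L"
    obtain a h where x: "a \<in> A" "h \<in> H" "a \<in> carrier L" "h \<in> carrier L" "x = a \<oplus> h"
      using decomp[OF xyz(1)] by blast
    obtain b k where y: "b \<in> A" "k \<in> H" "b \<in> carrier L" "k \<in> carrier L" "y = b \<oplus> k"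
      using decomp[OF xyz(2)] by blast
    obtain c l where z: "c \<in> A" "l \<in> H" "c \<in> carrier L" "l \<in> carrier L" "z = c \<oplus> l"
      using decomp[OF xyz(3)] by blast
    \<comment> \<open>The first three instances balance the terms with \<open>c\<close>,
      \<open>b\<close> and \<open>a\<close> in the \<open>A\<close>-part, the last one the
      \<open>H\<close>-part.\<close>
    note identities = leibniz[OF x(4) y(4) z(3)] leibniz[OF x(4) z(4) y(3)]
      mult_assoc_left[OF y(4) z(4) x(3)] leibniz[OF x(4) y(4) z(4)]
    have closed: "h \<otimes> k \<in> carrier L" "h \<otimes> l \<in> carrier L" "k \<otimes> l \<in> carrier L"
      using x y z by (simp_all add: mult_closed)
    show "x \<otimes>\<^bsub>?C\<^esub> (y \<otimes>\<^bsub>?C\<^esub> z) = (x \<otimes>\<^bsub>?C\<^esub> y) \<otimes>\<^bsub>?C\<^esub> z \<oplus> y \<otimes>\<^bsub>?C\<^esub> (x \<otimes>\<^bsub>?C\<^esub> z)"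
      using x y z memA memH closed
      by (simp add: cm) (simp add: norm identities M.a_ac)
  qed
  moreover have "lie_algebra_axioms ?C"
  proof (rule lie_algebra_axioms.intro, unfold simps)
    fix x assume "x \<in> carrier L"
    then obtain a h where x: "a \<in> A" "h \<in> H" "a \<in> carrier L" "h \<in> carrier L" "x = a \<oplus> h"
      using decomp by metis
    then show "x \<otimes>\<^bsub>?C\<^esub> x = \<zero>" by (simp add: cm sq mult_closed a_minus_def M.r_neg)
  qed
  ultimately show ?thesis
    by (intro lie_algebra.intro leibniz_algebra.intro nonassoc_algebra.intro K.field_axioms)
qed

end

section \<open>Algebras minimally not in a formation\<close>

context leibniz_alg
begin

text \<open>A formation is nonempty, so with closure under subalgebras it contains the zero
  subalgebra of some member, and with it every zero algebra of this type. This provides a nonzero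
  ideal from which to find a minimal one.\<close>

lemma not_in_formation_nonzero:
  assumes F: "formation K \<F>" "subalgebra_closed K \<F>" and "fin_dim K L" and "L \<notin> \<F>"
  shows "carrier L \<noteq> {\<zero>}"
proof
  assume zero: "carrier L = {\<zero>}"
  obtain X where X: "X \<in> \<F>" "fd_leibniz_algebra K X" using F unfolding formation_def by blast
  then interpret X: leibniz_algebra K X unfolding fd_leibniz_algebra_def by simp
  interpret X: leibniz_alg K X ..
  let ?Z = "X\<lparr>carrier := {\<zero>\<^bsub>X\<^esub>}\<rparr>"
  have "?Z \<in> \<F>" using F(2) X(1) X.subalgebra_zero unfolding subalgebra_closed_def by blast
  moreover have "alg_isomorphic K ?Z L"
    unfolding alg_isomorphic_def using mult_zero_l
    by (intro bexI[of _ "\<lambda>_. \<zero>"]) (auto simp: alg_hom_def bij_betw_def zero)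
  ultimately have "L \<in> \<F>"
    using F(1) assms(3) leibniz_algebra_axioms unfolding formation_def fd_leibniz_algebra_def
    by blast
  then show False using assms(4) by blast
qed

end

text \<open>The complement represents the quotient up to isomorphism. It is itself a Leibniz algebra
  as a member of the formation, which allows the isomorphism to be reversed.\<close>

lemma belongs_to_quotient_complement:
  assumes F: "formation K \<F>" and "leibniz_algebra K L" and I: "alg_ideal K L I"
    and H: "complementing_subalgebra K L I H" and mem: "L\<lparr>carrier := H\<rparr> \<in> \<F>"
  shows "belongs_to K (quotient_algebra L I) \<F>"
proof -
  interpret leibniz_algebra K L by fact
  interpret leibniz_alg K L ..
  have "fd_leibniz_algebra K (L\<lparr>carrier := H\<rparr>)" using F mem unfolding formation_def by blast
  then interpret H: leibniz_algebra K "L\<lparr>carrier := H\<rparr>" unfolding fd_leibniz_algebra_def by simp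
  interpret H: leibniz_alg K "L\<lparr>carrier := H\<rparr>" ..
  show ?thesis
    using H.alg_isomorphic_sym[OF alg_isomorphic_complement_quotient[OF I H]] mem
    unfolding belongs_to_def by blast
qed

text \<open>The quotient by zero has elements of another type, so membership is carried back to
  \<open>L\<close> along the isomorphism between them.\<close>

lemma in_formation_if_belongs_to_quotient_zero:
  assumes F: "formation K \<F>" and L: "fd_leibniz_algebra K L"
    and mem: "belongs_to K (quotient_algebra L {\<zero>\<^bsub>L\<^esub>}) \<F>"
  shows "L \<in> \<F>"
proof -
  interpret leibniz_algebra K L using L unfolding fd_leibniz_algebra_def by simp
  interpret leibniz_alg K L ..
  obtain Y where Y: "Y \<in> \<F>" "alg_isomorphic K (quotient_algebra L {\<zero>\<^bsub>L\<^esub>}) Y"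
    using mem unfolding belongs_to_def by blast
  have "alg_isomorphic K Y L"
    by (rule alg_isomorphic_sym[OF alg_isomorphic_trans[OF alg_isomorphic_quotient_zero Y(2)]])
  then show ?thesis using F L Y(1) unfolding formation_def by blast
qed

text \<open>Distinct minimal ideals meet in zero. Each has a proper subalgebra as complement, which
  lies in the formation and represents the quotient; intersecting the two ideals would put
  \<open>L\<close> itself into the formation.\<close>

lemma minimal_ideal_unique:
  assumes "formation K \<F>" and "leibniz_algebra K L" and "fin_dim K L"
    and "solvable_algebra K L" and "minimally_not_in K L \<F>"
    and "frattini_ideal K L = {\<zero>\<^bsub>L\<^esub>}"
    and A: "minimal_ideal K L A" and B: "minimal_ideal K L B"
  shows "B = A"
proof (rule ccontr)
  assume "B \<noteq> A"
  interpret leibniz_algebra K L by fact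
  interpret leibniz_alg K L ..
  have id: "alg_ideal K L A" "alg_ideal K L B" using A B unfolding minimal_ideal_def by auto
  have quot: "belongs_to K (quotient_algebra L I) \<F>" if I: "minimal_ideal K L I" for I
  proof -
    obtain M where M: "complementing_subalgebra K L I M" "M \<noteq> carrier L"
      using complement_of_minimal_ideal[OF assms(4,6) I] by blast
    then have "L\<lparr>carrier := M\<rparr> \<in> \<F>"
      using assms(5) unfolding minimally_not_in_def complementing_subalgebra_def by blast
    then show ?thesis
      using belongs_to_quotient_complement[OF assms(1,2) _ M(1)] I
      unfolding minimal_ideal_def by blast
  qed
  have "A \<inter> B = {\<zero>\<^bsub>L\<^esub>}"
    using alg_ideal_Int[OF id] A B \<open>B \<noteq> A\<close> unfolding minimal_ideal_def
    by (metis inf_le1 inf_le2)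
  moreover have "belongs_to K (quotient_algebra L (A \<inter> B)) \<F>"
    using assms(1-3) id quot[OF A] quot[OF B] unfolding formation_def fd_leibniz_algebra_def
    by blast
  ultimately have "L \<in> \<F>"
    using in_formation_if_belongs_to_quotient_zero[OF assms(1)] assms(2,3)
    unfolding fd_leibniz_algebra_def by simp
  then show False using assms(5) unfolding minimally_not_in_def by blast
qed

section \<open>Ideals in the presence of a unique minimal ideal\<close>

context leibniz_alg
begin

lemma ideal_eq_zero_if_meets_trivially:
  assumes "fin_dim K L" and unique: "\<And>B. minimal_ideal K L B \<Longrightarrow> B = A"
    and I: "alg_ideal K L I" and "A \<inter> I = {\<zero>}"
  shows "I = {\<zero>}"
proof (rule ccontr)
  assume "I \<noteq> {\<zero>}"
  then obtain B where "minimal_ideal K L B" "B \<subseteq> I" using ex_minimal_ideal[OF assms(1) I] by blast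
  then show False using unique assms(4) unfolding minimal_ideal_def by blast
qed

text \<open>As \<open>A\<close> is contained in \<open>N\<close>, the modular law splits
  \<open>N\<close> into \<open>A\<close> and \<open>N \<inter> H\<close>. The second part is an
  ideal that meets \<open>A\<close> trivially, hence zero.\<close>

lemma ideal_eq_if_complement_part_ideal:
  assumes "fin_dim K L" and unique: "\<And>B. minimal_ideal K L B \<Longrightarrow> B = A"
    and A: "alg_ideal K L A" and H: "complementing_subalgebra K L A H"
    and N: "submodule N K L" "A \<subseteq> N" "alg_ideal K L (N \<inter> H)"
  shows "N = A"
proof -
  have H': "submodule H K L" "carrier L = A <+> H" "A \<inter> H = {\<zero>}"
    using H unfolding complementing_subalgebra_def subalgebra_def by auto
  note s = submodule_subset[OF alg_idealD(1)[OF A]] submodule_subset[OF H'(1)]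
  have "A \<inter> (N \<inter> H) = {\<zero>}" using H'(3) N(2) by blast
  then have NH: "N \<inter> H = {\<zero>}"
    using ideal_eq_zero_if_meets_trivially[OF assms(1) unique N(3)] by blast
  have "x \<in> A" if x: "x \<in> N" for x
  proof -
    obtain a h where ah: "a \<in> A" "h \<in> H" "x = a \<oplus> h"
      using submodule_subset[OF N(1) x] unfolding H'(2) mem_set_add by blast
    then have "h \<in> N" using submodule_add_left_cancel[OF N(1), of a h] x N(2) s by blast
    then have "h = \<zero>" using NH ah by blast
    then show ?thesis using ah s by simp
  qed
  then show ?thesis using N(2) by blast
qed

text \<open>Uniqueness puts \<open>A\<close> inside \<open>leib K L\<close>, so products between the
  two vanish in both orders by \<open>leib_mult\<close>. Hence \<open>leib K L \<inter> H\<close> is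
  an ideal.\<close>

lemma leib_eq_minimal_ideal:
  assumes "fin_dim K L" and unique: "\<And>B. minimal_ideal K L B \<Longrightarrow> B = A"
    and A: "alg_ideal K L A" and H: "complementing_subalgebra K L A H"
    and "leib K L \<noteq> {\<zero>}"
  shows "leib K L = A"
proof (rule ideal_eq_if_complement_part_ideal[OF assms(1) unique A H submodule_leib])
  have H': "subalgebra K L H" "carrier L = A <+> H"
    using H unfolding complementing_subalgebra_def by auto
  note sub = subalgebraD[OF H'(1)] alg_idealD[OF A] alg_idealD[OF alg_ideal_leib]
  note s = submodule_subset[OF sub(1)] submodule_subset[OF sub(3)]
  show AL: "A \<subseteq> leib K L"
    using ex_minimal_ideal[OF assms(1) alg_ideal_leib assms(5)] unique by metis
  have zero: "\<zero> \<in> leib K L \<inter> H" using submodule_zero_mem sub(1,6) by auto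
  show "alg_ideal K L (leib K L \<inter> H)"
  proof (rule alg_ideal_of_complement[OF _ _ H'(2)])
    show "A \<subseteq> carrier L" "H \<subseteq> carrier L" using s by auto
    show "submodule (leib K L \<inter> H) K L" using sub by (intro submodule_Int)
    show "a \<otimes> n \<in> leib K L \<inter> H \<and> n \<otimes> a \<in> leib K L \<inter> H" if "a \<in> A" "n \<in> leib K L \<inter> H" for a n
      using that AL s zero by (auto simp: leib_mult)
    show "h \<otimes> n \<in> leib K L \<inter> H \<and> n \<otimes> h \<in> leib K L \<inter> H" if "h \<in> H" "n \<in> leib K L \<inter> H" for h n
      using that s sub by auto
  qed
qed

text \<open>An abelian \<open>A\<close> lies in its centralizer, and \<open>A\<close> annihilates
  the centralizer by definition; so the part of the centralizer inside \<open>H\<close> is an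
  ideal.\<close>

lemma centralizer_eq_minimal_ideal:
  assumes "fin_dim K L" and unique: "\<And>B. minimal_ideal K L B \<Longrightarrow> B = A"
    and A: "alg_ideal K L A" and H: "complementing_subalgebra K L A H"
    and abelian: "\<And>a b. a \<in> A \<Longrightarrow> b \<in> A \<Longrightarrow> a \<otimes> b = \<zero>"
  shows "alg_centralizer L A = A"
proof (rule ideal_eq_if_complement_part_ideal[OF assms(1) unique A H])
  let ?Z = "alg_centralizer L A"
  have H': "subalgebra K L H" "carrier L = A <+> H"
    using H unfolding complementing_subalgebra_def by auto
  note sub = subalgebraD[OF H'(1)] alg_idealD[OF A] alg_idealD[OF alg_ideal_centralizer[OF A]]
  note s = submodule_subset[OF sub(1)] submodule_subset[OF sub(3)]
  show "submodule ?Z K L" by (rule sub(6))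
  show "A \<subseteq> ?Z" using abelian s unfolding alg_centralizer_def by auto
  have zero: "\<zero> \<in> ?Z \<inter> H" using submodule_zero_mem sub(1,6) by auto
  show "alg_ideal K L (?Z \<inter> H)"
  proof (rule alg_ideal_of_complement[OF _ _ H'(2)])
    show "A \<subseteq> carrier L" "H \<subseteq> carrier L" using s by auto
    show "submodule (?Z \<inter> H) K L" using sub by (intro submodule_Int)
    show "a \<otimes> n \<in> ?Z \<inter> H \<and> n \<otimes> a \<in> ?Z \<inter> H" if "a \<in> A" "n \<in> ?Z \<inter> H" for a n
      using that zero unfolding alg_centralizer_def by auto
    show "h \<otimes> n \<in> ?Z \<inter> H \<and> n \<otimes> h \<in> ?Z \<inter> H" if "h \<in> H" "n \<in> ?Z \<inter> H" for h n
      using that s sub by auto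
  qed
qed

end

theorem lemma2p1:
  fixes K :: "('c, 'm) ring_scheme"
    and \<F> :: "('c, 'a) module set"
    and L :: "('c, 'a) module"
  assumes "field K"
    and "formation K \<F>"
    and "subalgebra_closed K \<F>"
    and "\<forall>X\<in>\<F>. solvable_algebra K X"
    and "leibniz_algebra K L"
    and "fin_dim K L"
    and "solvable_algebra K L"
    and "minimally_not_in K L \<F>"
    and "frattini_ideal K L = {\<zero>\<^bsub>L\<^esub>}"
  shows "\<exists>A. minimal_ideal K L A \<and> (\<forall>B. minimal_ideal K L B \<longrightarrow> B = A) \<and>
    (\<exists>H. complementing_subalgebra K L A H) \<and>
    (\<not> lie_algebra K L \<longrightarrow>
       A = leib K L \<and>
       alg_centralizer L A = A \<and>
       (\<forall>H. complementing_subalgebra K L A H \<longrightarrow>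
          lie_algebra K (L\<lparr>carrier := H\<rparr>) \<and>
          lie_algebra K (companion L A H)))"
proof -
  interpret leibniz_algebra K L by fact
  interpret leibniz_alg K L ..
  have "L \<notin> \<F>" using assms(8) unfolding minimally_not_in_def by blast
  then obtain A where A: "minimal_ideal K L A"
    using ex_minimal_ideal[OF assms(6) alg_ideal_carrier]
      not_in_formation_nonzero[OF assms(2,3,6)] by blast
  have unique: "B = A" if "minimal_ideal K L B" for B
    using minimal_ideal_unique[OF assms(2,5-9) A that] .
  have ideal: "alg_ideal K L A" using A unfolding minimal_ideal_def by blast
  obtain M where M: "complementing_subalgebra K L A M"
    using complement_of_minimal_ideal[OF assms(7,9) A] by blast
  have "A = leib K L \<and> alg_centralizer L A = A \<and>
      (\<forall>H. complementing_subalgebra K L A H \<longrightarrow>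
        lie_algebra K (L\<lparr>carrier := H\<rparr>) \<and> lie_algebra K (companion L A H))"
    if "\<not> lie_algebra K L"
  proof (intro conjI allI impI)
    have "leib K L \<noteq> {\<zero>\<^bsub>L\<^esub>}"
      using that square_mem_leib leibniz_algebra_axioms
      by (auto simp: lie_algebra_def lie_algebra_axioms_def)
    then show leib: "A = leib K L"
      using leib_eq_minimal_ideal[OF assms(6) unique ideal M] by simp
    show "alg_centralizer L A = A"
      by (rule centralizer_eq_minimal_ideal[OF assms(6) unique ideal M
            minimal_ideal_abelian[OF assms(7) A]])
    \<comment> \<open>The complement is arbitrary here and may differ from \<open>M\<close>.\<close>
    fix H assume H: "complementing_subalgebra K L A H"
    then have sub: "subalgebra K L H" and AH: "A \<inter> H = {\<zero>\<^bsub>L\<^esub>}"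
      unfolding complementing_subalgebra_def by auto
    have sq: "h \<otimes>\<^bsub>L\<^esub> h = \<zero>\<^bsub>L\<^esub>" if "h \<in> H" for h
      using that AH leib square_mem_leib submodule_subset[OF subalgebraD(1)[OF sub]]
        subalgebraD(2)[OF sub] by blast
    show "lie_algebra K (L\<lparr>carrier := H\<rparr>)" by (rule lie_algebra_subalgebra[OF sub sq])
    show "lie_algebra K (companion L A H)" by (rule lie_algebra_companion[OF ideal H sq])
  qed
  then show ?thesis using A unique M by blast
qed

end
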